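(* Let $C_m$ be the cycle graph of order $m$, $m\ge 3$. The graph $C_m$ is neither positively nor negatively pseudo-invertible for $m\neq 4$. The bipartite graph $C_4$ is positively and negatively pseudo-invertible. Path graphs $P_m$ are integrally positively and negatively invertible bipartite graphs for any even order $m$. The path graph $P_3$ is positively and negatively pseudo-invertible. The path graph $P_m$ is neither positively nor negatively pseudo-invertible for any odd order $m\neq 3$.
   Context: For a real symmetric $m\times m$ matrix $A$, $A^\dagger$ denotes its Moore-Penrose inverse. $A^\dagger$ is called positively (negatively) signable if there exists a diagonal matrix $D$ with diagonal entries in $\{+1,-1\}$ (a signature matrix) such that all entries of $DA^\dagger D$ are non-negative (non-positive). A graph with adjacency matrix $A$ is called positively (negatively) pseudo-invertible if $A^\dagger$ is positively (negatively) signable. It is called integrally positively (negatively) invertible if $A$ is invertible, $A^{-1}$ has integer entries, and $A^{-1}$ is positively (negatively) signable. "Positively and negatively" means both properties hold (possibly with different signature matrices). $C_m$ and $P_m$ are the (unweighted, simple) cycle and path on $m$ vertices.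
   Formalization: The last claim is proved for odd orders m ≥ 5 only; m = 1 is excluded because P_1 has adjacency matrix (0) with Moore-Penrose inverse (0), which is trivially both positively and negatively signable, so the claim fails there. *)

theory Defs
  imports "Jordan_Normal_Form.Matrix" "HOL-Computational_Algebra.Polynomial"
begin

subsection \<open>Moore-Penrose inverse of a real matrix\<close>

definition penrose_inverse :: "real mat \<Rightarrow> real mat \<Rightarrow> bool" where
  "penrose_inverse A X \<longleftrightarrow>
     X \<in> carrier_mat (dim_col A) (dim_row A) \<and>
     A * X * A = A \<and> X * A * X = X \<and>
     transpose_mat (A * X) = A * X \<and> transpose_mat (X * A) = X * A"

definition moore_penrose :: "real mat \<Rightarrow> real mat" where
  "moore_penrose A = (THE X. penrose_inverse A X)"

text \<open>
  The definite description is justified below: the Penrose equations have at most one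
  solution (\<open>penrose_inverse_unique\<close>), and for symmetric matrices they have one
  (\<open>penrose_inverse_exists\<close>).
\<close>

lemma penrose_inverse_unique:
  assumes "penrose_inverse A X" and "penrose_inverse A Y"
  shows "X = Y"
proof -
  define m n where "m = dim_row A" and "n = dim_col A"
  have A: "A \<in> carrier_mat m n" by (simp add: m_def n_def)
  have X: "X \<in> carrier_mat n m" and Y: "Y \<in> carrier_mat n m"
    using assms by (auto simp: penrose_inverse_def m_def n_def)
  have x: "A * X * A = A" "X * A * X = X"
    "transpose_mat (A * X) = A * X" "transpose_mat (X * A) = X * A"
    using assms(1) by (auto simp: penrose_inverse_def)
  have y: "A * Y * A = A" "Y * A * Y = Y"
    "transpose_mat (A * Y) = A * Y" "transpose_mat (Y * A) = Y * A"
    using assms(2) by (auto simp: penrose_inverse_def)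
  have AX: "A * X \<in> carrier_mat m m" and AY: "A * Y \<in> carrier_mat m m"
    and XA: "X * A \<in> carrier_mat n n" and YA: "Y * A \<in> carrier_mat n n"
    using A X Y by auto
  have "A * X = (A * Y * A) * X" by (simp only: y(1))
  also have "\<dots> = (A * Y) * (A * X)" using assoc_mult_mat[OF AY A X] .
  finally have 1: "A * X = (A * Y) * (A * X)" .
  have "A * Y = (A * X * A) * Y" by (simp only: x(1))
  also have "\<dots> = (A * X) * (A * Y)" using assoc_mult_mat[OF AX A Y] .
  finally have "transpose_mat (A * Y) = transpose_mat ((A * X) * (A * Y))" by (rule arg_cong)
  also have "\<dots> = (A * Y) * (A * X)" by (simp only: transpose_mult[OF AX AY] x(3) y(3))
  finally have eq1: "A * X = A * Y" unfolding y(3) 1[symmetric] ..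
  have "X * A = X * (A * (Y * A))" by (simp only: y(1) assoc_mult_mat[OF A Y A, symmetric])
  also have "\<dots> = (X * A) * (Y * A)" by (simp only: assoc_mult_mat[OF X A YA])
  finally have 2: "X * A = (X * A) * (Y * A)" .
  have "Y * A = Y * (A * (X * A))" by (simp only: x(1) assoc_mult_mat[OF A X A, symmetric])
  also have "\<dots> = (Y * A) * (X * A)" by (simp only: assoc_mult_mat[OF Y A XA])
  finally have "transpose_mat (Y * A) = transpose_mat ((Y * A) * (X * A))" by (rule arg_cong)
  also have "\<dots> = (X * A) * (Y * A)" by (simp only: transpose_mult[OF YA XA] x(4) y(4))
  finally have eq2: "X * A = Y * A" unfolding y(4) 2[symmetric] ..
  have "X = X * (A * X)" by (simp only: x(2) assoc_mult_mat[OF X A X, symmetric])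
  also have "\<dots> = X * A * Y" by (simp only: eq1 assoc_mult_mat[OF X A Y])
  also have "\<dots> = Y" by (simp only: eq2 y(2))
  finally show ?thesis .
qed

lemma generalized_inverse_exists:
  fixes A :: "real mat"
  assumes A: "A \<in> carrier_mat n n"
  shows "\<exists>G \<in> carrier_mat n n. A * G * A = A"
proof -
  interpret P: vector_space "smult :: real \<Rightarrow> real poly \<Rightarrow> real poly"
    by unfold_locales (auto simp: smult_add_right smult_add_left)
  interpret PP: vector_space_pair "smult :: real \<Rightarrow> real poly \<Rightarrow> real poly" "smult :: real \<Rightarrow> real poly \<Rightarrow> real poly"
    by unfold_locales
  define f where "f p = (\<Sum>i<n. monom (\<Sum>j<n. A $$ (i,j) * coeff p j) i)" for p :: "real poly"
  have cf: "coeff (f p) i = (if i < n then (\<Sum>j<n. A $$ (i,j) * coeff p j) else 0)" for p i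
    by (simp add: f_def coeff_sum)
  have lf: "Vector_Spaces.linear smult smult f"
    unfolding Vector_Spaces.linear_iff
    by (auto simp: P.vector_space_axioms poly_eq_iff cf sum.distrib sum_distrib_left algebra_simps)
  obtain g where lg: "Vector_Spaces.linear smult smult g" and g: "\<And>p. f (g (f p)) = f p"
    using PP.linear_exists_right_inverse_on[OF lf P.subspace_UNIV] by auto
  define G where "G = mat n n (\<lambda>(i,j). coeff (g (monom 1 j)) i)"
  have G: "G \<in> carrier_mat n n" by (simp add: G_def)
  have ent: "(A * B) $$ (i,j) = (\<Sum>k<n. A $$ (i,k) * B $$ (k,j))"
    if "i < n" "j < n" "A \<in> carrier_mat n n" "B \<in> carrier_mat n n" for i j and A B :: "real mat"
    using that by (simp add: scalar_prod_def atLeast0LessThan)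
  have "(A * (G * A)) $$ (i,j) = A $$ (i,j)" if ij: "i < n" "j < n" for i j
  proof -
    have fm: "f (monom 1 j) = (\<Sum>k<n. smult (A $$ (k,j)) (monom 1 k))"
      using ij by (simp add: f_def smult_monom if_distrib cong: if_cong)
    have "g (f (monom 1 j)) = (\<Sum>k<n. smult (A $$ (k,j)) (g (monom 1 k)))"
      unfolding fm by (simp add: PP.linear_sum[OF lg] PP.linear_scale[OF lg])
    hence cg: "coeff (g (f (monom 1 j))) l = (G * A) $$ (l,j)" if "l < n" for l
    proof -
      have "(G * A) $$ (l,j) = (\<Sum>k<n. G $$ (l,k) * A $$ (k,j))"
        using that ij by (intro ent G A)
      also have "\<dots> = (\<Sum>k<n. A $$ (k,j) * coeff (g (monom 1 k)) l)"
        using that by (intro sum.cong) (auto simp: G_def)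
      finally show ?thesis
        using \<open>g (f (monom 1 j)) = _\<close> by (simp add: coeff_sum)
    qed
    have "(A * (G * A)) $$ (i,j) = (\<Sum>k<n. A $$ (i,k) * (G * A) $$ (k,j))"
      using ij by (intro ent A mult_carrier_mat[OF G A])
    also have "\<dots> = (\<Sum>k<n. A $$ (i,k) * coeff (g (f (monom 1 j))) k)"
      by (intro sum.cong) (auto simp only: cg lessThan_iff)
    also have "\<dots> = coeff (f (g (f (monom 1 j)))) i"
      using ij by (simp only: cf[of "g _"] if_True)
    also have "\<dots> = A $$ (i,j)"
      using ij by (simp add: g cf if_distrib cong: if_cong)
    finally show ?thesis .
  qed
  hence "A * (G * A) = A" using A G by (intro eq_matI) auto
  thus ?thesis using assoc_mult_mat[OF A G A] G by auto
qed

lemma transpose_mult_self_zero: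
  fixes M :: "real mat"
  assumes M: "M \<in> carrier_mat n k" and 0: "transpose_mat M * M = 0\<^sub>m k k"
  shows "M = 0\<^sub>m n k"
proof (rule eq_matI)
  fix i j assume "i < dim_row (0\<^sub>m n k :: real mat)" "j < dim_col (0\<^sub>m n k :: real mat)"
  hence ij: "i < n" "j < k" by auto
  have "(\<Sum>l<n. M $$ (l,j) * M $$ (l,j)) = (transpose_mat M * M) $$ (j,j)"
    using M ij by (simp add: scalar_prod_def atLeast0LessThan)
  also have "\<dots> = 0" using ij by (simp add: 0)
  finally have "M $$ (i,j) * M $$ (i,j) = 0"
    using ij by (subst (asm) sum_nonneg_eq_0_iff) auto
  thus "M $$ (i,j) = 0\<^sub>m n k $$ (i,j)" using ij by simp
qed (use M in auto)

lemma symmetric_square_cancel_left: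
  fixes A :: "real mat"
  assumes A: "A \<in> carrier_mat n n" and sym: "transpose_mat A = A"
    and Y: "Y \<in> carrier_mat n k" and Z: "Z \<in> carrier_mat n k"
    and eq: "A * (A * Y) = A * (A * Z)"
  shows "A * Y = A * Z"
proof -
  define W where "W = Y - Z"
  have W: "W \<in> carrier_mat n k" using minus_carrier_mat[OF Z] by (simp add: W_def)
  have AW: "A * W = A * Y - A * Z"
    unfolding W_def by (rule mult_minus_distrib_mat[OF A Y Z])
  have "A * (A * W) = A * (A * Y) - A * (A * Z)"
    unfolding AW by (rule mult_minus_distrib_mat[OF A]) (use A Y Z in auto)
  also have "\<dots> = 0\<^sub>m n k" unfolding eq using A Z by auto
  finally have z: "A * (A * W) = 0\<^sub>m n k" .
  have "transpose_mat (A * W) * (A * W) = transpose_mat W * (A * (A * W))"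
    using transpose_mult[OF A W] sym A W assoc_mult_mat[of "transpose_mat W" k n A n "A * W" k]
    by simp
  also have "\<dots> = 0\<^sub>m k k" using z W by simp
  finally have "A * W = 0\<^sub>m n k"
    by (rule transpose_mult_self_zero[OF mult_carrier_mat[OF A W]])
  hence "A * Y - A * Z = 0\<^sub>m n k" using AW by simp
  hence 0: "(A * Y - A * Z) $$ (i,j) = 0" if "i < n" "j < k" for i j
    using that by simp
  have cY: "A * Y \<in> carrier_mat n k" and cZ: "A * Z \<in> carrier_mat n k"
    using A Y Z by auto
  show ?thesis
  proof (rule eq_matI)
    fix i j assume "i < dim_row (A * Z)" "j < dim_col (A * Z)"
    hence ij: "i < n" "j < k" using cZ by auto
    have "(A * Y - A * Z) $$ (i,j) = (A * Y) $$ (i,j) - (A * Z) $$ (i,j)"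
      using ij cZ by (intro index_minus_mat) auto
    thus "(A * Y) $$ (i,j) = (A * Z) $$ (i,j)" using 0[OF ij] by simp
  qed (use Y Z in auto)
qed

lemma symmetric_square_cancel_right:
  fixes A :: "real mat"
  assumes A: "A \<in> carrier_mat n n" and sym: "transpose_mat A = A"
    and Y: "Y \<in> carrier_mat k n" and Z: "Z \<in> carrier_mat k n"
    and eq: "Y * A * A = Z * A * A"
  shows "Y * A = Z * A"
proof -
  have t: "transpose_mat (U * A * A) = A * (A * transpose_mat U)"
    "transpose_mat (U * A) = A * transpose_mat U" if "U \<in> carrier_mat k n" for U
    using transpose_mult[of "U * A" k n A n] transpose_mult[of U k n A n] A sym that by auto
  have "A * (A * transpose_mat Y) = A * (A * transpose_mat Z)"
    unfolding t(1)[OF Y, symmetric] t(1)[OF Z, symmetric] eq ..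
  hence "A * transpose_mat Y = A * transpose_mat Z"
    by (rule symmetric_square_cancel_left[OF A sym, rotated 2]) (use Y Z in auto)
  hence "transpose_mat (Y * A) = transpose_mat (Z * A)"
    unfolding t(2)[OF Y] t(2)[OF Z] .
  thus ?thesis by (metis transpose_transpose)
qed

lemma penrose_inverse_exists:
  fixes A :: "real mat"
  assumes A: "A \<in> carrier_mat n n" and sym: "transpose_mat A = A"
  shows "\<exists>X. penrose_inverse A X"
proof -
  note as = assoc_mult_mat[of _ n n _ n _ n]
  have AAA: "A * A * A \<in> carrier_mat n n" using A by auto
  obtain G where G: "G \<in> carrier_mat n n" and g: "(A * A * A) * G * (A * A * A) = A * A * A"
    using generalized_inverse_exists[OF AAA] by auto
  have I: "1\<^sub>m n \<in> carrier_mat n n" by simp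
  have 1: "A * (A * (G * (A * (A * A)))) = A * (A * 1\<^sub>m n)"
    by (rule symmetric_square_cancel_left[OF A sym]) (use g A G in \<open>auto simp: as\<close>)
  have 2: "A * (G * (A * (A * A))) = A * 1\<^sub>m n"
    by (rule symmetric_square_cancel_left[OF A sym]) (use 1 A G in \<open>auto simp: as\<close>)
  have 3: "A * A * G * A * A = 1\<^sub>m n * A"
    by (rule symmetric_square_cancel_right[OF A sym]) (use 1 A G in \<open>auto simp: as\<close>)
  have 4: "A * (A * A) * G * A * A = A * A"
    using arg_cong[OF 3, of "\<lambda>M. A * M"] A G by (simp add: as)
  have 5: "A * (A * A) * G * A = 1\<^sub>m n * A"
    by (rule symmetric_square_cancel_right[OF A sym]) (use 4 A G in \<open>auto simp: as\<close>)
  have r2: "A * (G * (A * (A * A))) = A" and r3: "A * (A * (G * (A * A))) = A"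
    and r5: "A * (A * (A * (G * A))) = A"
    using 2 3 5 A G by (simp_all add: as)
  let ?T = "transpose_mat G"
  have T: "?T \<in> carrier_mat n n" using G by simp
  have trAll: "transpose_mat (B * C) = transpose_mat C * transpose_mat B"
    if "B \<in> carrier_mat n n" "C \<in> carrier_mat n n" for B C :: "real mat"
    using transpose_mult that .
  have t2: "A * (A * (A * (?T * A))) = A"
    using arg_cong[OF r2, of transpose_mat] A G T by (simp add: trAll sym as)
  have t5: "A * (?T * (A * (A * A))) = A"
    using arg_cong[OF r5, of transpose_mat] A G T by (simp add: trAll sym as)
  define X where "X = A * G * A"
  have X: "X \<in> carrier_mat n n" using A G by (simp add: X_def)
  have AX: "A * X = A * (A * (G * A))" and XA: "X * A = A * (G * (A * A))"
    using A G by (simp_all add: X_def as)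
  have tAX: "transpose_mat (A * X) = A * (?T * (A * A))"
    unfolding AX using A G T by (simp add: trAll sym as)
  have tXA: "transpose_mat (X * A) = A * (A * (?T * A))"
    unfolding XA using A G T by (simp add: trAll sym as)
  have "transpose_mat (A * X) * (A * X) = (A * (?T * (A * (A * A)))) * (A * (G * A))"
    unfolding tAX unfolding AX using A G T by (simp add: as)
  hence p: "transpose_mat (A * X) * (A * X) = A * X"
    unfolding t5 AX .
  have "(X * A) * transpose_mat (X * A) = A * (G * (A * (A * (A * (A * (?T * A))))))"
    unfolding tXA unfolding XA using A G T by (simp add: as)
  hence q: "(X * A) * transpose_mat (X * A) = X * A"
    unfolding t2 XA .
  have cAX: "A * X \<in> carrier_mat n n" and cXA: "X * A \<in> carrier_mat n n"
    using A X by auto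
  have s1: "transpose_mat (A * X) = A * X"
  proof -
    have "transpose_mat (A * X) = transpose_mat (transpose_mat (A * X) * (A * X))"
      by (simp only: p)
    also have "\<dots> = transpose_mat (A * X) * (A * X)"
      using trAll[of "transpose_mat (A * X)" "A * X"] cAX by simp
    finally show ?thesis unfolding p .
  qed
  have s2: "transpose_mat (X * A) = X * A"
  proof -
    have "transpose_mat (X * A) = transpose_mat ((X * A) * transpose_mat (X * A))"
      by (simp only: q)
    also have "\<dots> = (X * A) * transpose_mat (X * A)"
      using trAll[of "X * A" "transpose_mat (X * A)"] cXA by simp
    finally show ?thesis unfolding q .
  qed
  have e1: "A * X * A = A"
    unfolding AX using r3 A G by (simp add: as)
  have "X * A * X = (A * (G * (A * (A * A)))) * (G * A)"
    unfolding XA unfolding X_def using A G by (simp add: as)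
  hence e2: "X * A * X = X" unfolding r2 X_def using A G by (simp add: as)
  have "penrose_inverse A X"
    unfolding penrose_inverse_def by (intro conjI e1 e2 s1 s2) (use A X in simp)
  thus ?thesis ..
qed

lemma moore_penrose_eqI: "penrose_inverse A X \<Longrightarrow> moore_penrose A = X"
  unfolding moore_penrose_def using penrose_inverse_unique by (intro the_equality) auto

lemma penrose_inverse_moore_penrose:
  assumes "A \<in> carrier_mat n n" and "transpose_mat A = A"
  shows "penrose_inverse A (moore_penrose A)"
  using penrose_inverse_exists[OF assms] moore_penrose_eqI by blast

subsection \<open>Signability\<close>

definition signature_mat :: "nat \<Rightarrow> real mat \<Rightarrow> bool" where
  "signature_mat n D \<longleftrightarrow>
     D \<in> carrier_mat n n \<and> diagonal_mat D \<and> (\<forall>i<n. D $$ (i,i) \<in> {1, -1})"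

definition positively_signable :: "real mat \<Rightarrow> bool" where
  "positively_signable M \<longleftrightarrow>
     (\<exists>D. signature_mat (dim_row M) D \<and> (\<forall>x \<in> elements_mat (D * M * D). 0 \<le> x))"

definition negatively_signable :: "real mat \<Rightarrow> bool" where
  "negatively_signable M \<longleftrightarrow>
     (\<exists>D. signature_mat (dim_row M) D \<and> (\<forall>x \<in> elements_mat (D * M * D). x \<le> 0))"

subsection \<open>Graphs\<close>

text \<open>
  A finite simple graph of order \<open>m\<close> has vertices \<open>0, \<dots>, m - 1\<close>; its edges are
  two-element sets of vertices.
\<close>

record sgraph =
  gorder :: nat
  gedges :: "nat set set"

definition simple_graph :: "sgraph \<Rightarrow> bool" where
  "simple_graph G \<longleftrightarrow> (\<forall>e \<in> gedges G. e \<subseteq> {..<gorder G} \<and> card e = 2)"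

definition adjacency_mat :: "sgraph \<Rightarrow> real mat" where
  "adjacency_mat G =
     mat (gorder G) (gorder G) (\<lambda>(i,j). if {i,j} \<in> gedges G then 1 else 0)"

definition bipartite_graph :: "sgraph \<Rightarrow> bool" where
  "bipartite_graph G \<longleftrightarrow>
     (\<exists>U W. U \<union> W = {..<gorder G} \<and> U \<inter> W = {} \<and>
            (\<forall>e \<in> gedges G. \<exists>u \<in> U. \<exists>w \<in> W. e = {u, w}))"

definition cycle_graph :: "nat \<Rightarrow> sgraph" where
  "cycle_graph m = \<lparr>gorder = m, gedges = {{i, (i + 1) mod m} | i. i < m}\<rparr>"

definition path_graph :: "nat \<Rightarrow> sgraph" where
  "path_graph m = \<lparr>gorder = m, gedges = {{i, i + 1} | i. i + 1 < m}\<rparr>"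

lemma simple_graph_cycle_graph:
  assumes "3 \<le> m"
  shows "simple_graph (cycle_graph m)"
proof -
  have "i \<noteq> Suc i mod m" if "i < m" for i
    using assms that by (cases "Suc i = m") auto
  thus ?thesis using assms
    by (auto simp: simple_graph_def cycle_graph_def card_insert_if)
qed

lemma simple_graph_path_graph: "simple_graph (path_graph m)"
  by (auto simp: simple_graph_def path_graph_def)

lemma adjacency_mat_carrier: "adjacency_mat G \<in> carrier_mat (gorder G) (gorder G)"
  by (simp add: adjacency_mat_def)

lemma transpose_adjacency_mat: "transpose_mat (adjacency_mat G) = adjacency_mat G"
  by (rule eq_matI) (auto simp: adjacency_mat_def insert_commute)

lemma penrose_inverse_adjacency_mat:
  "penrose_inverse (adjacency_mat G) (moore_penrose (adjacency_mat G))"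
  using penrose_inverse_moore_penrose[OF adjacency_mat_carrier transpose_adjacency_mat] .

definition positively_pseudo_invertible :: "sgraph \<Rightarrow> bool" where
  "positively_pseudo_invertible G \<longleftrightarrow> positively_signable (moore_penrose (adjacency_mat G))"

definition negatively_pseudo_invertible :: "sgraph \<Rightarrow> bool" where
  "negatively_pseudo_invertible G \<longleftrightarrow> negatively_signable (moore_penrose (adjacency_mat G))"

definition integrally_positively_invertible :: "sgraph \<Rightarrow> bool" where
  "integrally_positively_invertible G \<longleftrightarrow>
     (\<exists>B. inverts_mat (adjacency_mat G) B \<and> inverts_mat B (adjacency_mat G) \<and>
          elements_mat B \<subseteq> \<int> \<and> positively_signable B)"

definition integrally_negatively_invertible :: "sgraph \<Rightarrow> bool" where
  "integrally_negatively_invertible G \<longleftrightarrow>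
     (\<exists>B. inverts_mat (adjacency_mat G) B \<and> inverts_mat B (adjacency_mat G) \<and>
          elements_mat B \<subseteq> \<int> \<and> negatively_signable B)"

end

theory Submission
  imports Defs "HOL-Number_Theory.Cong"
begin

text \<open>
  Everything is read off from a few entries of \<open>A\<^sup>\<dagger>\<close>; the matrix is written out only where it is
  integral or proportional to \<open>A\<close>.

  The obstruction: if \<open>M\<close> is positively or negatively signable, the product of its entries along a
  closed walk of length four is non-negative (\<open>signable_closed_walk_nonneg\<close>).  So it suffices to find
  four entries of \<open>A\<^sup>\<dagger>\<close> with negative product, and the walk \<open>0, 1, 2, 3, 0\<close> provides them for every
  cycle other than \<open>C\<^sub>4\<close> and every path of odd order at least five.

  To find their signs, let \<open>P\<close> be the orthogonal projection onto the kernel of \<open>A\<close>, so that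
  \<open>A A\<^sup>\<dagger> = 1 - P\<close>.  Multiplication by the adjacency matrix adds the values at the neighbours of a
  vertex, so this equation relates entries of \<open>A\<^sup>\<dagger>\<close> two steps apart.  In a path the recursion can be
  started at the end vertex, which has a single neighbour.  In a cycle it is started with the help of
  the rotational symmetry, which \<open>A\<^sup>\<dagger>\<close> inherits from \<open>A\<close> by uniqueness (\<open>X_invariant\<close>).  In both cases
  the four entries come out as linear functions of \<open>p = P\<^sub>0\<^sub>0\<close>.  Since \<open>A P = 0\<close>, the entries of \<open>P\<close> two
  steps apart are opposite, and since \<open>P\<close> is an orthogonal projection, \<open>p\<close> is the sum of the squares of
  row \<open>0\<close>.  Hence \<open>p \<le> 1/c\<close> once \<open>c\<close> distinct vertices are reached in double steps from \<open>0\<close>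
  (\<open>kernel_proj_diag_le\<close>).  In a cycle this, or \<open>p = 0\<close> if the double steps close up after an odd
  number of changes of sign, gives \<open>p < 1/3\<close>; in a path of odd order it gives \<open>p < 1/2\<close>, and \<open>p > 0\<close>
  because there is a kernel vector that does not vanish at \<open>0\<close>.  These bounds decide the signs.

  For the positive results, an even path has an explicit inverse with entries \<open>0, 1, -1\<close>
  (\<open>path_times_even_path_inverse\<close>), whereas \<open>C\<^sub>4\<close> and \<open>P\<^sub>3\<close> are complete bipartite, so that \<open>A\<^sup>3 = c A\<close>
  and \<open>A\<^sup>\<dagger> = A / c\<close> (\<open>X_eq_smult_if_cube\<close>).  All these matrices vanish between vertices of equal
  parity, and for such matrices positive signability entails negative signability
  (\<open>negatively_signable_of_positively_signable\<close>).
\<close>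

section \<open>Signability through signs and closed walks\<close>

lemma signature_conjugate_entry:
  assumes "signature_mat n D" "M \<in> carrier_mat n n" "i < n" "j < n"
  shows "(D * M * D) $$ (i,j) = D $$ (i,i) * M $$ (i,j) * D $$ (j,j)"
proof -
  have D: "D = mat_diag n (\<lambda>i. D $$ (i,i))"
    using assms(1) by (intro eq_matI) (auto simp: signature_mat_def diagonal_mat_def mat_diag_def)
  have "D * M * D = mat n n (\<lambda>(i,j). D $$ (i,i) * M $$ (i,j) * D $$ (j,j))"
    by (subst (1 2) D) (use assms(2) in \<open>auto simp: mat_diag_mult_left mat_diag_mult_right[of _ n]\<close>)
  thus ?thesis using assms(3,4) by simp
qed

lemma signature_mat_diag:
  "signature_mat n (mat_diag n d) \<longleftrightarrow> (\<forall>i<n. d i \<in> {1, -1})"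
  by (auto simp: signature_mat_def diagonal_mat_def mat_diag_def)

lemma signature_conjugate_all_entries:
  assumes M: "M \<in> carrier_mat n n"
  shows "(\<exists>D. signature_mat (dim_row M) D \<and> (\<forall>x \<in> elements_mat (D * M * D). Q x)) \<longleftrightarrow>
         (\<exists>d. (\<forall>i<n. d i \<in> {1, -1}) \<and> (\<forall>i<n. \<forall>j<n. Q (d i * M $$ (i,j) * d j)))"
    (is "?L \<longleftrightarrow> ?R")
proof
  assume ?L
  then obtain D where D: "signature_mat n D" and Q: "\<forall>x \<in> elements_mat (D * M * D). Q x"
    using M by auto
  have c: "D * M * D \<in> carrier_mat n n" using D M by (auto simp: signature_mat_def)
  have "Q (D $$ (i,i) * M $$ (i,j) * D $$ (j,j))" if "i < n" "j < n" for i j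
    using Q elements_matI[OF c that] signature_conjugate_entry[OF D M that] by auto
  thus ?R using D by (intro exI[of _ "\<lambda>i. D $$ (i,i)"]) (auto simp: signature_mat_def)
next
  assume ?R
  then obtain d where d: "\<forall>i<n. d i \<in> {1, -1}"
    and Q: "\<forall>i<n. \<forall>j<n. Q (d i * M $$ (i,j) * d j)" by blast
  have D: "signature_mat n (mat_diag n d)" using d by (simp add: signature_mat_diag)
  have dd: "mat_diag n d $$ (i,i) = d i" if "i < n" for i using that by (simp add: mat_diag_def)
  have "Q x" if "x \<in> elements_mat (mat_diag n d * M * mat_diag n d)" for x
  proof -
    obtain i j where ij: "i < dim_row (mat_diag n d * M * mat_diag n d)"
      "j < dim_col (mat_diag n d * M * mat_diag n d)"
      and x: "x = (mat_diag n d * M * mat_diag n d) $$ (i,j)"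
      using elements_matD[OF \<open>x \<in> _\<close>] by blast
    have ij': "i < n" "j < n" using ij by (auto simp: mat_diag_def)
    show ?thesis
      using Q ij' unfolding x signature_conjugate_entry[OF D M ij'] dd[OF ij'(1)] dd[OF ij'(2)]
      by blast
  qed
  thus ?L using D M by auto
qed

lemmas positively_signable_iff =
  signature_conjugate_all_entries[where Q = "\<lambda>x. 0 \<le> x", folded positively_signable_def]
lemmas negatively_signable_iff =
  signature_conjugate_all_entries[where Q = "\<lambda>x. x \<le> 0", folded negatively_signable_def]

text \<open>
  Along a closed walk every vertex sign occurs an even number of times, so conjugation by a
  signature matrix does not change the product of the entries met; and an even number of entries of
  one common sign has a non-negative product.  The length four makes this an obstruction to both
  kinds of signability at once.
\<close>

lemma signable_closed_walk_nonneg: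
  assumes M: "M \<in> carrier_mat n n"
    and s: "positively_signable M \<or> negatively_signable M"
    and v: "i < n" "j < n" "k < n" "l < n"
  shows "0 \<le> M $$ (i,j) * M $$ (j,k) * M $$ (k,l) * M $$ (l,i)"
proof -
  obtain d where d: "\<And>i. i < n \<Longrightarrow> d i \<in> {1, -1 :: real}"
    and dM: "(\<forall>i<n. \<forall>j<n. 0 \<le> d i * M $$ (i,j) * d j) \<or> (\<forall>i<n. \<forall>j<n. d i * M $$ (i,j) * d j \<le> 0)"
    using s unfolding positively_signable_iff[OF M] negatively_signable_iff[OF M] by blast
  define e where "e i j = d i * M $$ (i,j) * d j" for i j
  have e: "(0 \<le> e i j \<and> 0 \<le> e j k \<and> 0 \<le> e k l \<and> 0 \<le> e l i) \<or>
        (e i j \<le> 0 \<and> e j k \<le> 0 \<and> e k l \<le> 0 \<and> e l i \<le> 0)"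
    using dM v unfolding e_def by blast
  have "0 \<le> e i j * e j k" "0 \<le> e k l * e l i"
    using e by (elim disjE; simp add: mult_nonneg_nonneg mult_nonpos_nonpos)+
  hence "0 \<le> (e i j * e j k) * (e k l * e l i)" by (rule mult_nonneg_nonneg)
  also have "\<dots> = (d i * d i) * (d j * d j) * (d k * d k) * (d l * d l) *
      (M $$ (i,j) * M $$ (j,k) * M $$ (k,l) * M $$ (l,i))"
    by (simp add: e_def algebra_simps)
  also have "\<dots> = M $$ (i,j) * M $$ (j,k) * M $$ (k,l) * M $$ (l,i)"
    using v d[of i] d[of j] d[of k] d[of l] by auto
  finally show ?thesis .
qed

text \<open>
  If the non-zero entries join vertices of different parity, negating the signs of the odd vertices
  negates all of these entries.
\<close>

lemma negatively_signable_of_positively_signable: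
  assumes M: "M \<in> carrier_mat n n" and pos: "positively_signable M"
    and bip: "\<And>i j. i < n \<Longrightarrow> j < n \<Longrightarrow> even (i + j) \<Longrightarrow> M $$ (i,j) = 0"
  shows "negatively_signable M"
proof -
  obtain d where d: "\<forall>i<n. d i \<in> {1, -1 :: real}"
    and dM: "\<forall>i<n. \<forall>j<n. 0 \<le> d i * M $$ (i,j) * d j"
    using pos unfolding positively_signable_iff[OF M] by blast
  let ?d = "\<lambda>i. (-1) ^ i * d i"
  have "?d i * M $$ (i,j) * ?d j \<le> 0" if ij: "i < n" "j < n" for i j
  proof (cases "even (i + j)")
    case False
    hence "(-1) ^ i * (-1) ^ j = (-1 :: real)" by (simp flip: power_add)
    moreover have "?d i * M $$ (i,j) * ?d j = ((-1) ^ i * (-1) ^ j) * (d i * M $$ (i,j) * d j)"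
      by (simp only: ac_simps)
    ultimately have "?d i * M $$ (i,j) * ?d j = - (d i * M $$ (i,j) * d j)" by simp
    thus ?thesis using dM ij by simp
  qed (simp add: bip ij)
  moreover have "?d i \<in> {1, -1}" if "i < n" for i
    using d that by (cases "even i") auto
  ultimately show ?thesis
    unfolding negatively_signable_iff[OF M] by (intro exI[of _ ?d]) simp
qed

section \<open>The Moore-Penrose inverse of a symmetric matrix\<close>

lemma mult_mat_entry:
  assumes "A \<in> carrier_mat n k" "B \<in> carrier_mat k m" "i < n" "j < m"
  shows "(A * B) $$ (i,j) = (\<Sum>l<k. A $$ (i,l) * B $$ (l,j))"
  using assms by (simp add: scalar_prod_def atLeast0LessThan)

locale symmetric_matrix =
  fixes A :: "real mat" and n :: nat
  assumes carrier: "A \<in> carrier_mat n n" and symmetric: "transpose_mat A = A"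
begin

abbreviation X :: "real mat" where "X \<equiv> moore_penrose A"

text \<open>The orthogonal projection onto the kernel of \<^term>\<open>A\<close>.\<close>

definition kernel_proj :: "nat \<Rightarrow> nat \<Rightarrow> real" where
  "kernel_proj i j = (if i = j then 1 else 0) - (A * X) $$ (i,j)"

lemma X_penrose: "penrose_inverse A X"
  by (rule penrose_inverse_moore_penrose[OF carrier symmetric])

lemma X_carrier: "X \<in> carrier_mat n n"
  using X_penrose carrier by (auto simp: penrose_inverse_def)

text \<open>The transpose satisfies the same Penrose equations.\<close>

lemma X_symmetric: "transpose_mat X = X"
proof -
  have t: "transpose_mat (B * C) = transpose_mat C * transpose_mat B"
    if "B \<in> carrier_mat n n" "C \<in> carrier_mat n n" for B C :: "real mat"
    using transpose_mult that .
  note x = X_penrose[unfolded penrose_inverse_def] and as = assoc_mult_mat[of _ n n _ n _ n]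
  let ?Y = "transpose_mat X"
  have Y: "?Y \<in> carrier_mat n n" using X_carrier by simp
  have AY: "A * ?Y = X * A" and YA: "?Y * A = A * X"
    using x t[OF X_carrier carrier] t[OF carrier X_carrier] symmetric by auto
  have "A * ?Y * A = A"
    using arg_cong[of _ _ transpose_mat, OF conjunct1[OF conjunct2[OF x]]] symmetric X_carrier carrier Y
    by (simp add: t as)
  moreover have "?Y * A * ?Y = ?Y"
  proof -
    have "?Y * A * ?Y = ?Y * (A * ?Y)" using as Y carrier by simp
    also have "\<dots> = transpose_mat (X * A * X)"
      using t[OF mult_carrier_mat[OF X_carrier carrier] X_carrier] t[OF X_carrier carrier]
      by (simp only: symmetric)
    finally show ?thesis using x by simp
  qed
  moreover have "transpose_mat (A * ?Y) = A * ?Y" "transpose_mat (?Y * A) = ?Y * A"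
    using x by (simp_all add: AY YA)
  ultimately have "penrose_inverse A ?Y"
    using carrier Y by (simp add: penrose_inverse_def)
  from moore_penrose_eqI[OF this] show ?thesis by simp
qed

lemma X_commute: "X * A = A * X"
  using X_penrose transpose_mult[OF carrier X_carrier] X_symmetric symmetric
  by (simp add: penrose_inverse_def)

lemma X_sym: "i < n \<Longrightarrow> j < n \<Longrightarrow> X $$ (j,i) = X $$ (i,j)"
  using arg_cong[OF X_symmetric, of "\<lambda>M. M $$ (i,j)"] X_carrier by simp

lemma kernel_proj_sym: "i < n \<Longrightarrow> j < n \<Longrightarrow> kernel_proj j i = kernel_proj i j"
proof -
  assume "i < n" "j < n"
  moreover have "transpose_mat (A * X) = A * X"
    using X_penrose by (simp add: penrose_inverse_def)
  ultimately have "(A * X) $$ (j,i) = (A * X) $$ (i,j)"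
    using carrier X_carrier by (metis carrier_matD index_mult_mat(2,3) index_transpose_mat(1))
  thus ?thesis by (simp add: kernel_proj_def)
qed

lemma matrix_times_X:
  "i < n \<Longrightarrow> j < n \<Longrightarrow>
   (\<Sum>k<n. A $$ (i,k) * X $$ (k,j)) = (if i = j then 1 else 0) - kernel_proj i j"
  by (simp only: kernel_proj_def mult_mat_entry[OF carrier X_carrier])

lemma matrix_times_kernel_proj:
  assumes "i < n" "j < n"
  shows "(\<Sum>k<n. A $$ (i,k) * kernel_proj k j) = 0"
proof -
  have AX: "A * X \<in> carrier_mat n n" using carrier X_carrier by simp
  have "A * (A * X) = A * (X * A)" by (simp add: X_commute)
  also have "\<dots> = A"
    using X_penrose assoc_mult_mat[OF carrier X_carrier carrier] by (simp add: penrose_inverse_def)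
  finally have "(\<Sum>k<n. A $$ (i,k) * (A * X) $$ (k,j)) = A $$ (i,j)"
    using mult_mat_entry[OF carrier AX assms] by simp
  moreover have "(\<Sum>k<n. A $$ (i,k) * kernel_proj k j) =
    (\<Sum>k<n. if k = j then A $$ (i,k) else 0) - (\<Sum>k<n. A $$ (i,k) * (A * X) $$ (k,j))"
    unfolding sum_subtractf[symmetric]
    by (intro sum.cong) (simp_all add: kernel_proj_def right_diff_distrib)
  ultimately show ?thesis using assms by simp
qed

lemma kernel_proj_fixes_kernel:
  assumes v: "\<And>i. i < n \<Longrightarrow> (\<Sum>k<n. A $$ (i,k) * v k) = 0" and "i < n"
  shows "(\<Sum>k<n. kernel_proj i k * v k) = v i"
proof -
  have "(\<Sum>k<n. (X * A) $$ (i,k) * v k) = (\<Sum>k<n. \<Sum>l<n. X $$ (i,l) * A $$ (l,k) * v k)"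
    using \<open>i < n\<close> by (intro sum.cong) (auto simp: mult_mat_entry[OF X_carrier carrier] sum_distrib_right
        simp del: index_mult_mat)
  also have "\<dots> = (\<Sum>l<n. X $$ (i,l) * (\<Sum>k<n. A $$ (l,k) * v k))"
    by (subst sum.swap) (simp add: sum_distrib_left mult.assoc)
  also have "\<dots> = 0" using v by simp
  finally have 0: "(\<Sum>k<n. (A * X) $$ (i,k) * v k) = 0" by (simp only: X_commute)
  have "(\<Sum>k<n. kernel_proj i k * v k) =
    (\<Sum>k<n. (if i = k then 1 else 0) * v k) - (\<Sum>k<n. (A * X) $$ (i,k) * v k)"
    by (simp add: kernel_proj_def left_diff_distrib sum_subtractf)
  also have "\<dots> = v i"
    using \<open>i < n\<close> by (simp only: 0) (simp add: if_distrib[of "\<lambda>c. c * _"] cong: if_cong)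
  finally show ?thesis .
qed

lemma kernel_proj_diag:
  assumes "i < n"
  shows "kernel_proj i i = (\<Sum>k<n. (kernel_proj i k)\<^sup>2)"
proof -
  have "(\<Sum>k<n. kernel_proj i k * kernel_proj k i) = kernel_proj i i"
    using matrix_times_kernel_proj assms by (intro kernel_proj_fixes_kernel) auto
  moreover have "(\<Sum>k<n. kernel_proj i k * kernel_proj k i) = (\<Sum>k<n. (kernel_proj i k)\<^sup>2)"
    using assms by (intro sum.cong) (auto simp: kernel_proj_sym[of i] power2_eq_square)
  ultimately show ?thesis by simp
qed

text \<open>
  If the entries of row \<open>i\<close> have absolute value \<open>p = P\<^sub>i\<^sub>i\<close> at \<open>c\<close> places, their squares contribute
  \<open>c p\<^sup>2\<close> to the sum \<open>p\<close> of all squares in the row.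
\<close>

lemma kernel_proj_diag_le:
  assumes i: "i < n" and S: "S \<subseteq> {..<n}"
    and eq: "\<And>k. k \<in> S \<Longrightarrow> \<bar>kernel_proj i k\<bar> = \<bar>kernel_proj i i\<bar>" and "S \<noteq> {}"
  shows "kernel_proj i i \<le> 1 / card S"
proof -
  let ?p = "kernel_proj i i"
  have fin: "finite S" using S finite_subset by blast
  have "(kernel_proj i k)\<^sup>2 = ?p\<^sup>2" if "k \<in> S" for k
    using eq[OF that] by (metis power2_abs)
  hence "card S * ?p\<^sup>2 = (\<Sum>k\<in>S. (kernel_proj i k)\<^sup>2)" by simp
  also have "\<dots> \<le> (\<Sum>k<n. (kernel_proj i k)\<^sup>2)"
    using S by (intro sum_mono2) auto
  also have "\<dots> = ?p" using kernel_proj_diag[OF i] by simp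
  finally have le: "card S * ?p * ?p \<le> ?p" by (simp add: power2_eq_square mult.assoc)
  have c: "0 < real (card S)" using fin \<open>S \<noteq> {}\<close> by (simp add: card_gt_0_iff)
  show ?thesis
  proof (cases "?p > 0")
    case True
    with le have "card S * ?p \<le> 1" by simp
    thus ?thesis using c by (simp add: field_simps)
  next
    case False
    moreover have "0 \<le> 1 / real (card S)" by simp
    ultimately show ?thesis by linarith
  qed
qed

text \<open>
  The Penrose equations are preserved by simultaneous permutations of rows and columns, so by
  uniqueness the Moore-Penrose inverse has every symmetry of the matrix.
\<close>

lemma X_invariant:
  assumes \<sigma>: "bij_betw \<sigma> {..<n} {..<n}"
    and inv: "\<And>i j. i < n \<Longrightarrow> j < n \<Longrightarrow> A $$ (\<sigma> i, \<sigma> j) = A $$ (i,j)"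
    and "i < n" "j < n"
  shows "X $$ (\<sigma> i, \<sigma> j) = X $$ (i,j)"
proof -
  have \<sigma>n: "\<sigma> i < n" if "i < n" for i using bij_betwE[OF \<sigma>] that by auto
  define R where "R M = mat n n (\<lambda>(i,j). M $$ (\<sigma> i, \<sigma> j))" for M :: "real mat"
  have Rc: "R M \<in> carrier_mat n n" for M by (simp add: R_def)
  have RR: "R (M * N) = R M * R N"
    if M: "M \<in> carrier_mat n n" and N: "N \<in> carrier_mat n n" for M N
  proof (rule eq_matI)
    fix i j assume "i < dim_row (R M * R N)" "j < dim_col (R M * R N)"
    hence ij: "i < n" "j < n" using Rc by (auto simp: R_def)
    have "(R M * R N) $$ (i,j) = (\<Sum>k<n. R M $$ (i,k) * R N $$ (k,j))"
      by (rule mult_mat_entry[OF Rc Rc ij])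
    also have "\<dots> = (\<Sum>k<n. M $$ (\<sigma> i, \<sigma> k) * N $$ (\<sigma> k, \<sigma> j))"
      using ij by (simp add: R_def)
    also have "\<dots> = (\<Sum>k<n. M $$ (\<sigma> i, k) * N $$ (k, \<sigma> j))"
      by (rule sum.reindex_bij_betw[OF \<sigma>])
    also have "\<dots> = (M * N) $$ (\<sigma> i, \<sigma> j)"
      by (rule mult_mat_entry[OF M N, symmetric]) (use ij \<sigma>n in auto)
    also have "\<dots> = R (M * N) $$ (i,j)" using ij by (simp add: R_def)
    finally show "R (M * N) $$ (i,j) = (R M * R N) $$ (i,j)" ..
  qed (auto simp: R_def)
  have Rt: "transpose_mat (R M) = R M" if "M \<in> carrier_mat n n" "transpose_mat M = M" for M
  proof (rule eq_matI)
    fix i j assume "i < dim_row (R M)" "j < dim_col (R M)"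
    hence ij: "i < n" "j < n" by (auto simp: R_def)
    have "transpose_mat M $$ (\<sigma> i, \<sigma> j) = M $$ (\<sigma> j, \<sigma> i)" using that(1) \<sigma>n ij by simp
    thus "transpose_mat (R M) $$ (i,j) = R M $$ (i,j)" using ij that(2) by (simp add: R_def)
  qed (auto simp: R_def)
  have RA: "R A = A" using carrier inv by (intro eq_matI) (auto simp: R_def)
  note x = X_penrose[unfolded penrose_inverse_def]
  have AX: "A * X \<in> carrier_mat n n" and XA: "X * A \<in> carrier_mat n n"
    using carrier X_carrier by auto
  have "A * R X * A = A"
    using RR[OF AX carrier] RR[OF carrier X_carrier] x by (simp add: RA)
  moreover have "R X * A * R X = R X"
    using RR[OF XA X_carrier] RR[OF X_carrier carrier] x by (simp add: RA)
  moreover have "transpose_mat (A * R X) = A * R X"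
    using RR[OF carrier X_carrier] Rt[OF AX] x by (simp add: RA)
  moreover have "transpose_mat (R X * A) = R X * A"
    using RR[OF X_carrier carrier] Rt[OF XA] x by (simp add: RA)
  ultimately have "penrose_inverse A (R X)"
    using Rc carrier by (simp add: penrose_inverse_def)
  from moore_penrose_eqI[OF this] have "X = R X" .
  hence "X $$ (i,j) = R X $$ (i,j)" by (rule arg_cong)
  thus ?thesis using assms(3,4) by (simp add: R_def)
qed

text \<open>
  On the orthogonal complement of its kernel, which is its image, \<open>A\<close> satisfies \<open>A\<^sup>2 = c\<close>, so
  \<open>A / c\<close> inverts it there.
\<close>

lemma X_eq_smult_if_cube:
  assumes cube: "A * A * A = c \<cdot>\<^sub>m A" and c: "c \<noteq> 0"
  shows "X = (1 / c) \<cdot>\<^sub>m A"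
proof (rule moore_penrose_eqI)
  note sm = mult_smult_distrib[of _ n n _ n] mult_smult_assoc_mat[of _ n n _ n]
  have "transpose_mat (A * A) = A * A" using transpose_mult[OF carrier carrier] symmetric by simp
  moreover have "transpose_mat (k \<cdot>\<^sub>m M) = k \<cdot>\<^sub>m transpose_mat M" for k :: real and M
    by (rule eq_matI) auto
  ultimately show "penrose_inverse A ((1 / c) \<cdot>\<^sub>m A)"
    using carrier cube c by (auto simp: penrose_inverse_def sm mult.assoc)
qed

end

section \<open>Cycles\<close>

lemma symmetric_matrix_adjacency: "symmetric_matrix (adjacency_mat G) (gorder G)"
  by unfold_locales (rule adjacency_mat_carrier, rule transpose_adjacency_mat)

lemma cycle_entry:
  assumes "i < m" "j < m"
  shows "adjacency_mat (cycle_graph m) $$ (i,j) = (if j = (i + 1) mod m \<or> i = (j + 1) mod m then 1 else 0)"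
  using assms by (auto simp: adjacency_mat_def cycle_graph_def doubleton_eq_iff)

lemma cycle_neighbour_sum:
  fixes f :: "nat \<Rightarrow> real"
  assumes m: "3 \<le> m"
  shows "(\<Sum>k<m. adjacency_mat (cycle_graph m) $$ ((i + 1) mod m, k) * f k) =
         f (i mod m) + f ((i + 2) mod m)"
proof -
  have ne: "i mod m \<noteq> (i + 2) mod m"
  proof
    assume "i mod m = (i + 2) mod m"
    hence "[i + 0 = i + 2] (mod m)" by (simp add: cong_def)
    hence "[0 = 2] (mod m)" by (simp only: cong_add_lcancel_nat)
    thus False using m by (simp add: cong_def)
  qed
  have e: "adjacency_mat (cycle_graph m) $$ ((i + 1) mod m, k) =
      (if k = i mod m then 1 else 0) + (if k = (i + 2) mod m then 1 else 0)" if k: "k < m" for k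
  proof -
    have "(i + 1) mod m = (k + 1) mod m \<longleftrightarrow> [i + 1 = k + 1] (mod m)" by (simp add: cong_def)
    also have "\<dots> \<longleftrightarrow> i mod m = k mod m" by (simp only: cong_add_rcancel_nat) (simp add: cong_def)
    finally have 1: "(i + 1) mod m = (k + 1) mod m \<longleftrightarrow> k = i mod m" using k by auto
    have 2: "((i + 1) mod m + 1) mod m = (i + 2) mod m" by (simp add: mod_simps)
    have "(i + 1) mod m < m" using m by simp
    thus ?thesis using k ne by (subst cycle_entry) (auto simp only: 1 2 split: if_splits)
  qed
  have "(\<Sum>k<m. adjacency_mat (cycle_graph m) $$ ((i + 1) mod m, k) * f k) =
     (\<Sum>k<m. (if k = i mod m then f k else 0) + (if k = (i + 2) mod m then f k else 0))"
    by (intro sum.cong) (auto simp: e simp del: One_nat_def)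
  thus ?thesis using m by (simp add: sum.distrib)
qed

lemma cycle_rotation:
  assumes m: "3 \<le> m" and ij: "i < m" "j < m"
  shows "moore_penrose (adjacency_mat (cycle_graph m)) $$ ((i + 1) mod m, (j + 1) mod m) =
         moore_penrose (adjacency_mat (cycle_graph m)) $$ (i, j)"
proof -
  interpret symmetric_matrix "adjacency_mat (cycle_graph m)" m
    using symmetric_matrix_adjacency[of "cycle_graph m"] by (simp add: cycle_graph_def)
  have inj: "(k + 1) mod m = (l + 1) mod m \<longleftrightarrow> k = l" if "k < m" "l < m" for k l
  proof -
    have "(k + 1) mod m = (l + 1) mod m \<longleftrightarrow> [k + 1 = l + 1] (mod m)" by (simp add: cong_def)
    also have "\<dots> \<longleftrightarrow> k mod m = l mod m" by (simp only: cong_add_rcancel_nat) (simp add: cong_def)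
    finally show ?thesis using that by simp
  qed
  have io: "inj_on (\<lambda>k. (k + 1) mod m) {..<m}" by (rule inj_onI) (use inj in auto)
  have sub: "(\<lambda>k. (k + 1) mod m) ` {..<m} \<subseteq> {..<m}" using m by auto
  have bij: "bij_betw (\<lambda>k. (k + 1) mod m) {..<m} {..<m}"
    using io endo_inj_surj[OF _ sub io] by (simp add: bij_betw_def)
  have inv: "adjacency_mat (cycle_graph m) $$ ((k + 1) mod m, (l + 1) mod m) =
     adjacency_mat (cycle_graph m) $$ (k, l)" if "k < m" "l < m" for k l
  proof -
    have lt: "(k + 1) mod m < m" "(l + 1) mod m < m" using m by auto
    show ?thesis
      unfolding cycle_entry[OF lt] cycle_entry[OF that] inj[OF that(2) lt(1)] inj[OF that(1) lt(2)] ..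
  qed
  show ?thesis by (rule X_invariant[OF bij inv ij])
qed

text \<open>
  Let \<open>p\<close> be the common diagonal entry of the projection \<open>P\<close> onto the kernel.  Rows of \<open>P\<close> lie in the
  kernel, so their entries change sign at every second vertex.  Comparing entries in
  \<open>A A\<^sup>\<dagger> = 1 - P\<close> gives \<open>(1 - p) / 2\<close> for the entry of \<open>A\<^sup>\<dagger>\<close> at vertices of distance one, and
  \<open>(3 p - 1) / 2\<close> at vertices three steps apart.  The four vertices \<open>0, 2, 4, 6\<close> are distinct modulo
  \<open>m\<close>, which forces \<open>p \<le> 1/4\<close>, unless \<open>6\<close> is a multiple of \<open>m\<close>, which forces \<open>p = -p\<close>, or \<open>m = 4\<close>.
\<close>

lemma cycle_not_signable:
  assumes m: "3 \<le> m" and m4: "m \<noteq> 4"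
  shows "\<not> positively_pseudo_invertible (cycle_graph m) \<and>
         \<not> negatively_pseudo_invertible (cycle_graph m)"
proof -
  let ?A = "adjacency_mat (cycle_graph m)"
  interpret symmetric_matrix ?A m
    using symmetric_matrix_adjacency[of "cycle_graph m"] by (simp add: cycle_graph_def)
  define p where "p = kernel_proj 0 0"
  have lt: "k mod m < m" for k using m by simp
  have alt: "kernel_proj 0 (j mod m) = - kernel_proj 0 (i mod m)" if "j = i + 2" for i j
    using matrix_times_kernel_proj[OF lt[of "i + 1"] lt[of 0]]
    unfolding cycle_neighbour_sum[OF m] that using kernel_proj_sym[of 0] m by simp
  have P: "kernel_proj 0 (2 mod m) = - p" "kernel_proj 0 (4 mod m) = p" "kernel_proj 0 (6 mod m) = - p"
    using alt[of 2 0] alt[of 4 2] alt[of 6 4] by (simp_all add: p_def)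
  have p: "p \<le> 1 / 4"
  proof (cases "m = 3 \<or> m = 6")
    case True
    hence "6 mod m = 0" by auto
    hence "p = - p" using P(3) by (simp add: p_def)
    thus ?thesis by simp
  next
    case False
    \<comment> \<open>For \<open>m = 5\<close> the fourth vertex is \<open>6 mod 5 = 1\<close>.\<close>
    let ?S = "{0, 2 mod m, 4 mod m, 6 mod m}"
    have "card ?S = 4"
    proof (cases "m = 5")
      case False
      hence "m \<ge> 7" using m m4 \<open>\<not> (m = 3 \<or> m = 6)\<close> by linarith
      thus ?thesis by simp
    qed simp
    moreover have "kernel_proj 0 0 \<le> 1 / card ?S"
      using P m by (intro kernel_proj_diag_le) (auto simp: p_def)
    ultimately show ?thesis by (simp add: p_def)
  qed
  \<comment> \<open>Vertices are kept modulo \<open>m\<close>, so that the triangle is covered: there \<open>3\<close> is the vertex \<open>0\<close> again.\<close>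
  define a where "a = X $$ (1 mod m, 0)"
  have rot: "X $$ (k mod m, l mod m) = X $$ (i mod m, j mod m)" if "k = i + 1" "l = j + 1" for i j k l
    using cycle_rotation[OF m lt[of i] lt[of j]] unfolding that by (simp only: mod_simps)
  have a01: "X $$ (0, 1 mod m) = a" using X_sym[OF lt[of 0] lt[of 1]] by (simp add: a_def)
  have a12: "X $$ (1 mod m, 2 mod m) = a" using rot[of 1 0 2 1] a01 by simp
  have a23: "X $$ (2 mod m, 3 mod m) = a" using rot[of 2 1 3 2] a12 by simp
  have am0: "X $$ ((m - 1) mod m, 0) = a"
    using rot[of m "m - 1" 1 0] a01 m by simp
  \<comment> \<open>Row \<open>m\<close> is row \<open>0\<close>, addressed through its neighbours \<open>m - 1\<close> and \<open>m + 1\<close>.\<close>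
  have e: "m - 1 + 1 = m" "m - 1 + 2 = m + 1" using m by simp_all
  have 0: "2 * a = 1 - p"
    using matrix_times_X[OF lt[of "(m - 1) + 1"] lt[of 0]]
    unfolding cycle_neighbour_sum[OF m]
    unfolding e mod_self mod_0 mod_add_self1 am0 a_def[symmetric] p_def[symmetric] by simp
  have P20: "kernel_proj (2 mod m) 0 = - p"
    using P(1) kernel_proj_sym[OF lt[of 0] lt[of 2]] by simp
  have s: "1 + 1 = (2 :: nat)" "1 + 2 = (3 :: nat)" and "2 mod m \<noteq> 0" using m by simp_all
  hence "X $$ (3 mod m, 0) + a = p"
    using matrix_times_X[OF lt[of "1 + 1"] lt[of 0]]
    unfolding cycle_neighbour_sum[OF m]
    unfolding s mod_0 P20 a_def[symmetric] by simp
  with 0 p have "X $$ (3 mod m, 0) < 0" "0 < a" by simp_all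
  hence "a * a * a * X $$ (3 mod m, 0) < 0" by (simp add: mult_pos_neg)
  hence "X $$ (0, 1 mod m) * X $$ (1 mod m, 2 mod m) * X $$ (2 mod m, 3 mod m) * X $$ (3 mod m, 0) < 0"
    by (simp only: a01 a12 a23)
  thus ?thesis
    using signable_closed_walk_nonneg[OF X_carrier _ lt[of 0] lt[of 1] lt[of 2] lt[of 3]]
    unfolding positively_pseudo_invertible_def negatively_pseudo_invertible_def
    by (metis mod_0 not_less)
qed

section \<open>Paths\<close>

lemma path_entry:
  assumes "i < m" "j < m"
  shows "adjacency_mat (path_graph m) $$ (i,j) = (if j = i + 1 \<or> i = j + 1 then 1 else 0)"
  using assms by (auto simp: adjacency_mat_def path_graph_def doubleton_eq_iff)

lemma path_neighbour_sum:
  fixes f :: "nat \<Rightarrow> real"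
  assumes "i < m"
  shows "(\<Sum>k<m. adjacency_mat (path_graph m) $$ (i,k) * f k) =
         (if 0 < i then f (i - 1) else 0) + (if i + 1 < m then f (i + 1) else 0)"
proof -
  have "(\<Sum>k<m. adjacency_mat (path_graph m) $$ (i,k) * f k) =
     (\<Sum>k<m. (if k = i - 1 then if 0 < i then f k else 0 else 0) + (if k = i + 1 then f k else 0))"
    using assms by (intro sum.cong) (auto simp: path_entry)
  thus ?thesis using assms by (auto simp: sum.distrib)
qed

lemma path_bipartite: "bipartite_graph (path_graph m)"
proof -
  have "\<exists>u \<in> {i. i < m \<and> even i}. \<exists>w \<in> {i. i < m \<and> odd i}. {k, k + 1} = {u, w}"
    if "k + 1 < m" for k
  proof (cases "even k")
    case True
    thus ?thesis using that by (intro bexI[of _ k] bexI[of _ "k + 1"]) auto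
  next
    case False
    thus ?thesis using that by (intro bexI[of _ "k + 1"] bexI[of _ k]) auto
  qed
  thus ?thesis
    unfolding bipartite_graph_def path_graph_def
    by (intro exI[of _ "{i. i < m \<and> even i}"] exI[of _ "{i. i < m \<and> odd i}"]) auto
qed

text \<open>
  With \<open>p\<close> the first diagonal entry of the kernel projection, the entries of \<open>A\<^sup>\<dagger>\<close> between the
  vertices \<open>0, 2\<close> and the vertices \<open>1, 3\<close> are \<open>1 - p\<close>, \<open>2 p - 1\<close>, \<open>p\<close> and \<open>1 - 2 p\<close>.  Their product
  is negative as soon as \<open>0 < p < 1/2\<close>.  The lower bound expresses that the path has the kernel vector
  \<open>(1, 0, -1, 0, 1, \<dots>)\<close>, the upper one that this vector has at least three non-zero entries.
\<close>

lemma odd_path_not_signable: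
  assumes m: "5 \<le> m" and odd: "odd m"
  shows "\<not> positively_pseudo_invertible (path_graph m) \<and>
         \<not> negatively_pseudo_invertible (path_graph m)"
proof -
  let ?A = "adjacency_mat (path_graph m)"
  interpret symmetric_matrix ?A m
    using symmetric_matrix_adjacency[of "path_graph m"] by (simp add: path_graph_def)
  define p where "p = kernel_proj 0 0"
  have alt: "kernel_proj k j = - kernel_proj i j" if "k = i + 2" "k < m" "j < m" for i j k
    using matrix_times_kernel_proj[of "i + 1" j] that by (simp add: path_neighbour_sum)
  have P20: "kernel_proj 2 0 = - p" and P40: "kernel_proj 4 0 = p"
    using alt[of 2 0 0] alt[of 4 2 0] m by (simp_all add: p_def)
  have P02: "kernel_proj 0 2 = - p" and P04: "kernel_proj 0 4 = p"
    using P20 P40 kernel_proj_sym[of 0] m by auto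
  have P22: "kernel_proj 2 2 = p" using alt[of 2 0 2] P02 m by simp
  have "kernel_proj 0 0 \<le> 1 / card {0::nat, 2, 4}"
    using P02 P04 m by (intro kernel_proj_diag_le) (auto simp: p_def)
  hence upper: "p \<le> 1 / 3" by (simp add: p_def)
  have lower: "0 < p"
  proof -
    \<comment> \<open>The projection fixes the kernel vector \<open>v\<close>, so its row \<open>0\<close> cannot vanish.\<close>
    define v :: "nat \<Rightarrow> real" where "v i = (if even i then (-1) ^ (i div 2) else 0)" for i
    have "(\<Sum>k<m. ?A $$ (i,k) * v k) = 0" if i: "i < m" for i
    proof (cases "even i")
      case True
      thus ?thesis using i by (auto simp: path_neighbour_sum v_def)
    next
      case False
      then obtain b where b: "i = 2 * b + 1" by (elim oddE)
      moreover have "i + 1 < m" using i odd False by (metis Suc_eq_plus1 Suc_lessI even_Suc)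
      ultimately show ?thesis using i by (simp add: path_neighbour_sum v_def)
    qed
    hence v: "(\<Sum>k<m. kernel_proj 0 k * v k) = v 0"
      using m by (intro kernel_proj_fixes_kernel) auto
    have diag: "p = (\<Sum>k<m. (kernel_proj 0 k)\<^sup>2)"
      unfolding p_def using m by (intro kernel_proj_diag) simp
    have "p \<noteq> 0"
    proof
      assume "p = 0"
      hence "\<forall>k<m. kernel_proj 0 k = 0"
        using diag by (simp add: sum_nonneg_eq_0_iff)
      thus False using v by (simp add: v_def)
    qed
    moreover have "0 \<le> p" unfolding diag by (intro sum_nonneg) simp
    ultimately show ?thesis by simp
  qed
  have x10: "X $$ (1,0) = 1 - p"
    using matrix_times_X[of 0 0] m by (simp add: path_neighbour_sum p_def)
  have x30: "X $$ (3,0) = 2 * p - 1"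
    using matrix_times_X[of 2 0] m x10 P20 by (simp add: path_neighbour_sum)
  have x12: "X $$ (1,2) = p"
    using matrix_times_X[of 0 2] m P02 by (simp add: path_neighbour_sum)
  have x32: "X $$ (3,2) = 1 - 2 * p"
    using matrix_times_X[of 2 2] m x12 P22 by (simp add: path_neighbour_sum)
  have "X $$ (0,1) = 1 - p" "X $$ (2,3) = 1 - 2 * p"
    using X_sym[of 1 0] X_sym[of 3 2] m x10 x32 by simp_all
  moreover have "((1 - p) * p * (1 - 2 * p)) * (2 * p - 1) < 0"
    using lower upper by (intro mult_pos_neg mult_pos_pos) auto
  ultimately have "X $$ (0,1) * X $$ (1,2) * X $$ (2,3) * X $$ (3,0) < 0"
    by (simp only: x12 x30)
  thus ?thesis
    using signable_closed_walk_nonneg[OF X_carrier, of 0 1 2 3] m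
    unfolding positively_pseudo_invertible_def negatively_pseudo_invertible_def by force
qed

text \<open>
  The inverse of the path on an even number of vertices.  The edges \<open>{0, 1}, {2, 3}, \<dots>\<close> form its
  perfect matching; an entry is non-zero exactly if the two vertices are joined by a path that
  alternates between edges inside and outside the matching and starts and ends inside, and its sign
  is the parity of the number of edges used outside the matching.
\<close>

definition even_path_inverse :: "nat \<Rightarrow> real mat" where
  "even_path_inverse m = mat m m (\<lambda>(i,j).
     if even i \<and> odd j \<and> i < j \<or> odd i \<and> even j \<and> j < i
     then (-1) ^ (i div 2) * (-1) ^ (j div 2) else 0)"

lemma even_path_inverse_carrier: "even_path_inverse m \<in> carrier_mat m m"
  by (simp add: even_path_inverse_def)

lemma path_times_even_path_inverse:
  assumes "even m"
  shows "adjacency_mat (path_graph m) * even_path_inverse m = 1\<^sub>m m"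
proof (rule eq_matI)
  have A: "adjacency_mat (path_graph m) \<in> carrier_mat m m"
    using adjacency_mat_carrier[of "path_graph m"] by (simp add: path_graph_def)
  fix i j assume "i < dim_row (1\<^sub>m m :: real mat)" "j < dim_col (1\<^sub>m m :: real mat)"
  hence ij: "i < m" "j < m" by simp_all
  have sum: "(adjacency_mat (path_graph m) * even_path_inverse m) $$ (i,j) =
      (if 0 < i then even_path_inverse m $$ (i - 1, j) else 0) +
      (if i + 1 < m then even_path_inverse m $$ (i + 1, j) else 0)"
    unfolding mult_mat_entry[OF A even_path_inverse_carrier ij] by (rule path_neighbour_sum[OF ij(1)])
  have "\<dots> = (if i = j then 1 else 0)"
  proof (cases "even i")
    case True
    then obtain a where a: "i = 2 * a" by blast
    have "i + 1 < m" using assms True ij by (metis Suc_eq_plus1 Suc_lessI even_Suc)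
    thus ?thesis using ij a
      by (cases a; cases "even j") (auto simp: even_path_inverse_def elim!: evenE; presburger)+
  next
    case False
    then obtain a where a: "i = 2 * a + 1" by (elim oddE)
    show ?thesis
    proof (cases "even j")
      case True
      thus ?thesis using ij a by (auto simp: even_path_inverse_def)
    next
      case False
      then obtain b where b: "j = 2 * b + 1" by (elim oddE)
      consider "b < a" | "b = a" | "a < b" by linarith
      thus ?thesis using ij a b by cases (auto simp: even_path_inverse_def)
    qed
  qed
  thus "(adjacency_mat (path_graph m) * even_path_inverse m) $$ (i,j) = 1\<^sub>m m $$ (i,j)"
    using sum ij by simp
qed (auto simp: even_path_inverse_def adjacency_mat_def path_graph_def)

lemma even_path_integrally_invertible:
  assumes "even m"
  shows "integrally_positively_invertible (path_graph m)"
    and "integrally_negatively_invertible (path_graph m)"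
proof -
  let ?A = "adjacency_mat (path_graph m)" and ?B = "even_path_inverse m"
  note B = even_path_inverse_carrier[of m]
  have A: "?A \<in> carrier_mat m m"
    using adjacency_mat_carrier[of "path_graph m"] by (simp add: path_graph_def)
  have AB: "?A * ?B = 1\<^sub>m m" by (rule path_times_even_path_inverse[OF assms])
  have "transpose_mat ?B = ?B" by (rule eq_matI) (auto simp: even_path_inverse_def)
  hence BA: "?B * ?A = 1\<^sub>m m"
    using transpose_mult[OF A B] AB transpose_adjacency_mat[of "path_graph m"] by simp
  have int: "elements_mat ?B \<subseteq> \<int>"
    by (auto dest!: elements_matD simp: even_path_inverse_def)
  have "0 \<le> (-1) ^ (i div 2) * ?B $$ (i,j) * (-1) ^ (j div 2)" if "i < m" "j < m" for i j
    using that by (simp add: even_path_inverse_def flip: power_add) (simp add: algebra_simps flip: power_add)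
  moreover have "(-1) ^ (i div 2) \<in> {1, -1 :: real}" for i :: nat
    by (cases "even (i div 2)") auto
  ultimately have pos: "positively_signable ?B"
    unfolding positively_signable_iff[OF B] by (intro exI[of _ "\<lambda>i. (-1) ^ (i div 2)"]) simp
  have neg: "negatively_signable ?B"
    by (rule negatively_signable_of_positively_signable[OF B pos]) (auto simp: even_path_inverse_def)
  have "inverts_mat ?A ?B" "inverts_mat ?B ?A"
    using A B AB BA by (simp_all add: inverts_mat_def)
  thus "integrally_positively_invertible (path_graph m)"
    "integrally_negatively_invertible (path_graph m)"
    using int pos neg
    unfolding integrally_positively_invertible_def integrally_negatively_invertible_def by blast+
qed

section \<open>The four-cycle and the path on three vertices\<close>

text \<open>
  Here \<open>A\<^sup>\<dagger> = A / c\<close> has the sign pattern of \<open>A\<close>: it is non-negative as it stands, and it vanishes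
  between vertices of equal parity.
\<close>

lemma pseudo_invertible_if_cube:
  assumes cube: "adjacency_mat G * adjacency_mat G * adjacency_mat G = c \<cdot>\<^sub>m adjacency_mat G"
    and c: "0 < c"
    and bip: "\<And>i j. {i, j} \<in> gedges G \<Longrightarrow> odd (i + j)"
  shows "positively_pseudo_invertible G" and "negatively_pseudo_invertible G"
proof -
  interpret symmetric_matrix "adjacency_mat G" "gorder G" by (rule symmetric_matrix_adjacency)
  have X: "X = (1 / c) \<cdot>\<^sub>m adjacency_mat G" using X_eq_smult_if_cube[OF cube] c by simp
  have entry: "X $$ (i,j) = (if {i,j} \<in> gedges G then 1 / c else 0)"
    if "i < gorder G" "j < gorder G" for i j
    using that unfolding X by (simp add: adjacency_mat_def)
  have pos: "positively_signable X"
    unfolding positively_signable_iff[OF X_carrier]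
    by (intro exI[of _ "\<lambda>_. 1"]) (use c entry in auto)
  moreover have "negatively_signable X"
    by (rule negatively_signable_of_positively_signable[OF X_carrier pos]) (use entry bip in auto)
  ultimately show "positively_pseudo_invertible G" and "negatively_pseudo_invertible G"
    by (simp_all add: positively_pseudo_invertible_def negatively_pseudo_invertible_def)
qed

text \<open>
  The matrix belongs to the complete bipartite graph between the even and the odd vertices.  A walk
  of length three from one side to the other chooses its second and third vertex freely, which makes
  \<open>1 * 2\<close> or \<open>2 * 2\<close> walks.
\<close>

lemma parity_matrix_cube:
  fixes A :: "real mat"
  assumes A: "A \<in> carrier_mat n n"
    and entry: "\<And>i j. i < n \<Longrightarrow> j < n \<Longrightarrow> A $$ (i,j) = (if odd (i + j) then 1 else 0)"
    and n: "n = 3 \<and> c = 2 \<or> n = 4 \<and> c = 4"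
  shows "A * A * A = c \<cdot>\<^sub>m A"
proof (rule eq_matI)
  define a where "a i j = (if odd (i + j) then 1 else 0 :: real)" for i j :: nat
  have Aa: "A $$ (i,j) = a i j" if "i < n" "j < n" for i j
    using entry[OF that] by (simp add: a_def)
  fix i j assume "i < dim_row (c \<cdot>\<^sub>m A)" "j < dim_col (c \<cdot>\<^sub>m A)"
  hence ij: "i < n" "j < n" using A by auto
  have AA: "(A * A) $$ (i,l) = (\<Sum>k<n. a i k * a k l)" if "l < n" for l
    unfolding mult_mat_entry[OF A A ij(1) that] by (intro sum.cong) (simp_all add: Aa ij that)
  have "(A * A * A) $$ (i,j) = (\<Sum>l<n. (A * A) $$ (i,l) * A $$ (l,j))"
    by (rule mult_mat_entry[OF mult_carrier_mat[OF A A] A ij])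
  also have "\<dots> = (\<Sum>l<n. (\<Sum>k<n. a i k * a k l) * a l j)"
    by (intro sum.cong refl) (simp only: AA Aa ij lessThan_iff)
  also have "\<dots> = c * a i j"
  proof -
    have "(\<Sum>k<4. f k) = f 0 + f 1 + f 2 + f 3" "(\<Sum>k<3. f k) = f 0 + f 1 + f 2"
      for f :: "nat \<Rightarrow> real"
      by (simp_all add: eval_nat_numeral)
    thus ?thesis
      using n by (elim disjE conjE; cases "even i"; cases "even j"; simp add: a_def)
  qed
  finally show "(A * A * A) $$ (i,j) = (c \<cdot>\<^sub>m A) $$ (i,j)" using A ij by (simp add: Aa)
qed simp_all

lemma cycle4_cube:
  "adjacency_mat (cycle_graph 4) * adjacency_mat (cycle_graph 4) * adjacency_mat (cycle_graph 4) =
   4 \<cdot>\<^sub>m adjacency_mat (cycle_graph 4)"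
proof (rule parity_matrix_cube)
  show "adjacency_mat (cycle_graph 4) \<in> carrier_mat 4 4"
    by (simp add: adjacency_mat_def cycle_graph_def)
  fix i j :: nat assume ij: "i < 4" "j < 4"
  hence "i = 0 \<or> i = 1 \<or> i = 2 \<or> i = 3" "j = 0 \<or> j = 1 \<or> j = 2 \<or> j = 3" by linarith+
  hence "j = (i + 1) mod 4 \<or> i = (j + 1) mod 4 \<longleftrightarrow> odd (i + j)" by (elim disjE; simp)
  thus "adjacency_mat (cycle_graph 4) $$ (i,j) = (if odd (i + j) then 1 else 0)"
    by (simp only: cycle_entry[OF ij])
qed simp

lemma path3_cube:
  "adjacency_mat (path_graph 3) * adjacency_mat (path_graph 3) * adjacency_mat (path_graph 3) =
   2 \<cdot>\<^sub>m adjacency_mat (path_graph 3)"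
proof (rule parity_matrix_cube)
  show "adjacency_mat (path_graph 3) \<in> carrier_mat 3 3"
    by (simp add: adjacency_mat_def path_graph_def)
  fix i j :: nat assume ij: "i < 3" "j < 3"
  hence "i = 0 \<or> i = 1 \<or> i = 2" "j = 0 \<or> j = 1 \<or> j = 2" by linarith+
  hence "j = i + 1 \<or> i = j + 1 \<longleftrightarrow> odd (i + j)" by (elim disjE; simp)
  thus "adjacency_mat (path_graph 3) $$ (i,j) = (if odd (i + j) then 1 else 0)"
    by (simp only: path_entry[OF ij])
qed simp

lemma cycle4_edge_parity: "{i, j} \<in> gedges (cycle_graph 4) \<Longrightarrow> odd (i + j)"
proof -
  assume "{i, j} \<in> gedges (cycle_graph 4)"
  then obtain k where k: "k < 4" "{i, j} = {k, (k + 1) mod 4}" by (auto simp: cycle_graph_def)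
  have "even ((k + 1) mod 4) \<longleftrightarrow> odd k" by (simp add: dvd_mod_iff)
  thus ?thesis using k(2) by (auto simp: doubleton_eq_iff)
qed

lemma cycle4_bipartite: "bipartite_graph (cycle_graph 4)"
  unfolding bipartite_graph_def
proof (intro exI conjI ballI)
  show "{0, 2} \<union> {1, 3} = {..<gorder (cycle_graph 4)}" by (auto simp: cycle_graph_def)
  show "{0, 2} \<inter> {1, 3 :: nat} = {}" by simp
  fix e assume "e \<in> gedges (cycle_graph 4)"
  then obtain k where k: "k < 4" "e = {k, (k + 1) mod 4}" by (auto simp: cycle_graph_def)
  hence "k \<in> {0, 1, 2, 3}" by auto
  thus "\<exists>u\<in>{0, 2}. \<exists>w\<in>{1, 3}. e = {u, w}" using k(2) by (auto simp: doubleton_eq_iff)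
qed


theorem proposition2p3:
  shows "(\<forall>m\<ge>3. m \<noteq> 4 \<longrightarrow>
            \<not> positively_pseudo_invertible (cycle_graph m) \<and>
            \<not> negatively_pseudo_invertible (cycle_graph m)) \<and>
         (bipartite_graph (cycle_graph 4) \<and>
            positively_pseudo_invertible (cycle_graph 4) \<and>
            negatively_pseudo_invertible (cycle_graph 4)) \<and>
         (\<forall>m\<ge>1. even m \<longrightarrow>
            bipartite_graph (path_graph m) \<and>
            integrally_positively_invertible (path_graph m) \<and>
            integrally_negatively_invertible (path_graph m)) \<and>
         (positively_pseudo_invertible (path_graph 3) \<and>
            negatively_pseudo_invertible (path_graph 3)) \<and>
         (\<forall>m\<ge>2. odd m \<and> m \<noteq> 3 \<longrightarrow>
            \<not> positively_pseudo_invertible (path_graph m) \<and>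
            \<not> negatively_pseudo_invertible (path_graph m))"
proof (intro conjI allI impI; (elim conjE)?)
  fix m :: nat assume "3 \<le> m" "m \<noteq> 4"
  thus "\<not> positively_pseudo_invertible (cycle_graph m)" "\<not> negatively_pseudo_invertible (cycle_graph m)"
    using cycle_not_signable by blast+
next
  show "bipartite_graph (cycle_graph 4)" by (rule cycle4_bipartite)
  show "positively_pseudo_invertible (cycle_graph 4)" "negatively_pseudo_invertible (cycle_graph 4)"
    using pseudo_invertible_if_cube[OF cycle4_cube _ cycle4_edge_parity] by simp_all
next
  fix m :: nat assume "even m"
  thus "bipartite_graph (path_graph m)" "integrally_positively_invertible (path_graph m)"
    "integrally_negatively_invertible (path_graph m)"
    using path_bipartite even_path_integrally_invertible by blast+
next
  have "odd (i + j)" if "{i, j} \<in> gedges (path_graph 3)" for i j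
    using that by (auto simp: path_graph_def doubleton_eq_iff)
  thus "positively_pseudo_invertible (path_graph 3)" "negatively_pseudo_invertible (path_graph 3)"
    using pseudo_invertible_if_cube[OF path3_cube] by simp_all
next
  fix m :: nat assume "2 \<le> m" "odd m" "m \<noteq> 3"
  moreover from this have "5 \<le> m" by presburger
  ultimately show "\<not> positively_pseudo_invertible (path_graph m)"
    "\<not> negatively_pseudo_invertible (path_graph m)"
    using odd_path_not_signable by blast+
qed

end
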